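(* Let $I=[a,b)$ be a bounded nonempty real interval and let $p\ge 1$. Then $$\sup_{\alpha\in\mathfrak{S}_2(I)}\|\mathcal{Q}_{\alpha,p}\|_{(p,p)}=C(1/p)^{1/p}=\frac{2\cdot 2^{1/p}-1}{2^{1/p}-1},\qquad\text{where } C(r):=\left(\frac{2^{r+1}-1}{2^r-1}\right)^{1/r}\text{ for } r>0.$$
   Context: Dyadic lattice: for $J=[c,d)$ let $J_-$ and $J_+$ be its left and right halves (half-open). Define $\mathcal{D}_0(I)=\{I\}$, $\mathcal{D}_{k+1}(I)=\{J_-,J_+: J\in\mathcal{D}_k(I)\}$ and $\mathcal{D}(I)=\bigcup_{k\ge 0}\mathcal{D}_k(I)$. Write $|E|$ for Lebesgue measure and $\langle f\rangle_J=\frac1{|J|}\int_J f(t)\,dt$. A binary sequence adapted to $I$ is a family $\alpha=\{\alpha_J\}_{J\in\mathcal{D}(I)}$ with $\alpha_J\in\{0,1\}$. For $J\in\mathcal{D}(I)$ put $A(\alpha;J)=\frac1{|J|}\sum_{K\in\mathcal{D}(J)}\alpha_K|K|$. The set $\mathfrak{S}_2(I)$ consists of all binary sequences adapted to $I$ that are $2$-Carleson, i.e. $\sup_{J\in\mathcal{D}(I)}A(\alpha;J)\le 2$. For $p\ge1$ and $\alpha\in\mathfrak{S}_2(I)$ the power-mean sparse operator is $$\mathcal{Q}_{\alpha,p}f(t)=\sum_{J\in\mathcal{D}(I)}\alpha_J\,\langle|f|^p\rangle_J^{1/p}\,\mathbf{1}_J(t),\qquad t\in I.$$ $\|\mathcal{Q}_{\alpha,p}\|_{(p,p)}$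 denotes the operator norm $\|\mathcal{Q}_{\alpha,p}:L^p(I)\to L^{p,\infty}(I)\|$ with respect to Lebesgue measure, i.e. $$\|\mathcal{Q}_{\alpha,p}\|_{(p,p)}=\sup_{f,\lambda}\left(\frac{\lambda^p}{\langle f^p\rangle_I}\,\frac1{|I|}\,|\{t\in I:\mathcal{Q}_{\alpha,p}f(t)\ge\lambda\}|\right)^{1/p},$$ the supremum being over all $f\ge0$ in $L^p(I)$ with $\langle f^p\rangle_I>0$ and all $\lambda>0$. *)

theory Defs
  imports "HOL-Analysis.Analysis"
begin

primrec dyadic_gen :: "nat \<Rightarrow> real set \<Rightarrow> real set set" where
  "dyadic_gen 0 I = {I}"
| "dyadic_gen (Suc k) I =
     {K. \<exists>c d. c < d \<and> {c..<d} \<in> dyadic_gen k I \<and>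
              (K = {c..<(c + d) / 2} \<or> K = {(c + d) / 2..<d})}"

definition dyadic :: "real set \<Rightarrow> real set set" where
  "dyadic I = (\<Union>k. dyadic_gen k I)"

definition avg :: "(real \<Rightarrow> real) \<Rightarrow> real set \<Rightarrow> real" where
  "avg f J = (LINT t:J|lebesgue. f t) / measure lebesgue J"

definition adapted_binary :: "real set \<Rightarrow> (real set \<Rightarrow> real) \<Rightarrow> bool" where
  "adapted_binary I \<alpha> \<longleftrightarrow> (\<forall>J\<in>dyadic I. \<alpha> J \<in> {0, 1})"

text \<open>Series of nonnegative terms and suprema that may be infinite are taken in \<^typ>\<open>ennreal\<close>.\<close>

definition carleson_avg :: "(real set \<Rightarrow> real) \<Rightarrow> real set \<Rightarrow> ennreal" where
  "carleson_avg \<alpha> J =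
     (\<Sum>\<^sub>\<infinity>K\<in>dyadic J. ennreal (\<alpha> K * measure lebesgue K)) / ennreal (measure lebesgue J)"

text \<open>Only the values of a sequence on \<^term>\<open>dyadic I\<close> are constrained or ever used.\<close>

definition carleson2 :: "real set \<Rightarrow> (real set \<Rightarrow> real) set" where
  "carleson2 I = {\<alpha>. adapted_binary I \<alpha> \<and> (SUP J\<in>dyadic I. carleson_avg \<alpha> J) \<le> 2}"

definition sparse_op ::
    "real set \<Rightarrow> (real set \<Rightarrow> real) \<Rightarrow> real \<Rightarrow> (real \<Rightarrow> real) \<Rightarrow> real \<Rightarrow> ennreal" where
  "sparse_op I \<alpha> p f t =
     (\<Sum>\<^sub>\<infinity>J\<in>dyadic I.
        ennreal (\<alpha> J * avg (\<lambda>s. \<bar>f s\<bar> powr p) J powr (1 / p) * indicator J t))"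

definition Lp_on :: "real \<Rightarrow> real set \<Rightarrow> (real \<Rightarrow> real) set" where
  "Lp_on p I = {f. f \<in> borel_measurable (lebesgue_on I) \<and>
                   integrable (lebesgue_on I) (\<lambda>t. \<bar>f t\<bar> powr p)}"

text \<open>The superlevel set lies in \<open>I\<close>, so for bounded \<open>I\<close> its measure is finite and each
  quotient is a real number; only the supremum needs \<^typ>\<open>ennreal\<close>.\<close>

definition weak_norm :: "real set \<Rightarrow> (real set \<Rightarrow> real) \<Rightarrow> real \<Rightarrow> ennreal" where
  "weak_norm I \<alpha> p =
     (SUP (f, l) \<in> {(f, l). f \<in> Lp_on p I \<and> (\<forall>t\<in>I. 0 \<le> f t) \<and>
                          0 < avg (\<lambda>t. f t powr p) I \<and> 0 < l}.
        ennreal ((l powr p / avg (\<lambda>t. f t powr p) I * (1 / measure lebesgue I) *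
                  measure lebesgue {t \<in> I. ennreal l \<le> sparse_op I \<alpha> p f t}) powr (1 / p)))"

definition sharp_const :: "real \<Rightarrow> real" where
  "sharp_const r = ((2 powr (r + 1) - 1) / (2 powr r - 1)) powr (1 / r)"

end

theory Submission
  imports Defs
begin

text \<open>
  Put \<open>r = 1 / p\<close>, \<open>w = 2 powr r / (2 powr r - 1)\<close> and \<open>g = \<bar>f\<bar> powr p\<close>. The claimed constant
  is \<open>1 + w\<close>, and the weak-type inequality to be proved says
  \<open>l * (m / X) powr r \<le> 1 + w\<close>, where \<open>m\<close> is the measure of the superlevel set at height \<open>l\<close> and
  \<open>X\<close> is the integral of \<open>g\<close> over the interval.

  For the upper bound this inequality is strengthened so that it can be proved by induction on
  the dyadic scale. A third quantity enters, the Carleson mass \<open>S = (\<Sum>K. \<alpha> K * \<bar>K\<bar>)\<close> of the interval,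
  and the induction carries
  \<open>l * (m / X) powr r + w * (m / S) powr r \<le> 1 + w\<close> for \<open>m > 0\<close> (\<open>level_bound\<close>). In other words the
  Bellman function of the problem is bounded by the concave function obtained by solving this
  relation with equality for \<open>m\<close>, capped at \<open>\<bar>I\<bar>\<close>. Two things make the induction work.
  If \<open>\<alpha> I = 0\<close>, then \<open>m\<close>, \<open>X\<close> and \<open>S\<close> of \<open>I\<close> are the sums of those of its halves, and the relation
  survives addition because \<open>x powr (- r)\<close> is convex (\<open>level_bound_add\<close>). If \<open>\<alpha> I = 1\<close>, then in
  addition \<open>S\<close> grows by \<open>L = \<bar>I\<bar>\<close> and the level by \<open>(X / L) powr r\<close>; since the mass of the halves
  together is at most \<open>L\<close> by the Carleson condition, the extra \<open>(m / L) powr r\<close> is paid for by the drop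
  of the second term, with equality when the mass equals \<open>L\<close> (\<open>level_bound_jump\<close>).
  This is where \<open>w\<close> comes from: it solves \<open>1 + w * (1 / 2) powr r = w\<close>.
  Truncating the operator at a finite scale makes the induction possible, and monotone
  convergence removes the truncation (\<open>sparse_op_weak_type\<close>).

  For the lower bound, take the intervals \<open>J\<^sub>0 \<supset> J\<^sub>1 \<supset> \<dots> \<supset> J\<^sub>n\<close> in which every interval is the left half of
  its predecessor, together with both halves of \<open>J\<^sub>n\<close>, and let \<open>f\<close> be the indicator of \<open>J\<^sub>n\<close>.
  Each \<open>J\<^sub>i\<close> then has Carleson average exactly 2, and on \<open>J\<^sub>n\<close> the operator equals
  \<open>1 + (\<Sum>j\<le>n. 2 powr (- j * r))\<close>, where the summand 1 comes from the two halves. The weak-type quotient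
  is at least this number, which tends to \<open>1 + w\<close> (\<open>weak_norm_left_chain_ge\<close>, \<open>chain_levels_tendsto\<close>).
\<close>

section \<open>Dyadic intervals\<close>

text \<open>The definition splits the intervals of the last generation. Induction over scales needs the
opposite reading: first halve the interval itself, then pass to the descendants of each half.\<close>

lemma dyadic_gen_Suc_split:
  assumes "c < d"
  shows "dyadic_gen (Suc k) {c..<d} =
    dyadic_gen k {c..<(c + d) / 2} \<union> dyadic_gen k {(c + d) / 2..<d}"
proof (induction k)
  case 0
  show ?case using assms by (auto simp: Ico_eq_Ico)
next
  case (Suc k)
  show ?case
    unfolding dyadic_gen.simps(2)[of "Suc k" "{c..<d}"] Suc dyadic_gen.simps(2)[of k "{c..<(c + d) / 2}"]
      dyadic_gen.simps(2)[of k "{(c + d) / 2..<d}"] by blast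
qed

lemma dyadic_genE:
  assumes "J \<in> dyadic_gen k {c..<d}" "c < d"
  obtains u v where "J = {u..<v}" "u < v" "c \<le> u" "v \<le> d" "v - u = (d - c) / 2 ^ k"
proof -
  have "\<exists>u v. J = {u..<v} \<and> u < v \<and> c \<le> u \<and> v \<le> d \<and> v - u = (d - c) / 2 ^ k"
    using assms
  proof (induction k arbitrary: c d)
    case 0
    then show ?case by auto
  next
    case (Suc k)
    define e where "e = (c + d) / 2"
    have e: "c < e" "e < d" using Suc.prems(2) by (auto simp: e_def)
    have h: "(e - c) / 2 ^ k = (d - c) / 2 ^ Suc k" "(d - e) / 2 ^ k = (d - c) / 2 ^ Suc k"
      by (auto simp: e_def field_simps)
    from Suc.prems have "J \<in> dyadic_gen k {c..<e} \<or> J \<in> dyadic_gen k {e..<d}"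
      unfolding dyadic_gen_Suc_split[OF Suc.prems(2)] e_def by blast
    then show ?case
    proof
      assume "J \<in> dyadic_gen k {c..<e}"
      from Suc.IH[OF this e(1)] show ?thesis using e h by force
    next
      assume "J \<in> dyadic_gen k {e..<d}"
      from Suc.IH[OF this e(2)] show ?thesis using e h by force
    qed
  qed
  then show thesis using that by blast
qed

definition dyadic_below :: "nat \<Rightarrow> real set \<Rightarrow> real set set" where
  "dyadic_below n I = (\<Union>k<n. dyadic_gen k I)"

lemma dyadic_below_Suc:
  assumes "c < d"
  shows "dyadic_below (Suc n) {c..<d} = insert {c..<d}
    (dyadic_below n {c..<(c + d) / 2} \<union> dyadic_below n {(c + d) / 2..<d})"
  unfolding dyadic_below_def lessThan_Suc_eq_insert_0
  by (simp add: dyadic_gen_Suc_split[OF assms] del: dyadic_gen.simps(2)) auto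

lemma finite_dyadic_below: "c < d \<Longrightarrow> finite (dyadic_below n {c..<d})"
proof (induction n arbitrary: c d)
  case 0 then show ?case by (simp add: dyadic_below_def)
next
  case (Suc n)
  then have "c < (c + d) / 2" "(c + d) / 2 < d" by auto
  then show ?case using Suc by (simp add: dyadic_below_Suc)
qed

lemma dyadic_belowE:
  assumes "J \<in> dyadic_below n {c..<d}" "c < d"
  obtains u v where "J = {u..<v}" "u < v" "c \<le> u" "v \<le> d"
  using assms unfolding dyadic_below_def by (auto elim!: dyadic_genE)

text \<open>The three parts are disjoint because dyadic intervals are nonempty and lie inside their ancestor.
This recursion is the induction step for both the truncated operator and the Carleson mass.\<close>

lemma sum_dyadic_below_Suc:
  fixes F :: "real set \<Rightarrow> 'a::comm_monoid_add"
  assumes "c < d"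
  defines "e \<equiv> (c + d) / 2"
  shows "sum F (dyadic_below (Suc n) {c..<d}) =
    F {c..<d} + (sum F (dyadic_below n {c..<e}) + sum F (dyadic_below n {e..<d}))"
proof -
  have e: "c < e" "e < d" using assms by auto
  have 1: "{c..<d} \<notin> dyadic_below n {c..<e}"
    by (rule notI, erule dyadic_belowE) (use e in \<open>auto simp: Ico_eq_Ico\<close>)
  have 2: "{c..<d} \<notin> dyadic_below n {e..<d}"
    by (rule notI, erule dyadic_belowE) (use e in \<open>auto simp: Ico_eq_Ico\<close>)
  have 3: "J \<notin> dyadic_below n {e..<d}" if "J \<in> dyadic_below n {c..<e}" for J
  proof
    assume "J \<in> dyadic_below n {e..<d}"
    then obtain u v where "J = {u..<v}" "u < v" "e \<le> u" using e by (auto elim: dyadic_belowE)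
    moreover from dyadic_belowE[OF that e(1)]
    obtain u' v' where "J = {u'..<v'}" "u' < v'" "v' \<le> e" by metis
    ultimately show False by (auto simp: Ico_eq_Ico)
  qed
  have fin: "finite (dyadic_below n {c..<e})" "finite (dyadic_below n {e..<d})"
    using e by (auto intro: finite_dyadic_below)
  have "sum F (dyadic_below n {c..<e} \<union> dyadic_below n {e..<d}) =
      sum F (dyadic_below n {c..<e}) + sum F (dyadic_below n {e..<d})"
    using fin 3 by (intro sum.union_disjoint) auto
  then show ?thesis
    unfolding dyadic_below_Suc[OF assms(1)] e_def[symmetric] using fin 1 2 by simp
qed

lemma UN_dyadic_below: "(\<Union>n. dyadic_below n I) = dyadic I"
  by (auto simp: dyadic_below_def dyadic_def)

lemma dyadic_below_subset: "dyadic_below n I \<subseteq> dyadic I"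
  using UN_dyadic_below by auto

lemma dyadic_half_subset:
  assumes "c < d"
  shows "dyadic {c..<(c + d) / 2} \<subseteq> dyadic {c..<d}" "dyadic {(c + d) / 2..<d} \<subseteq> dyadic {c..<d}"
  unfolding UN_dyadic_below[symmetric] using dyadic_below_Suc[OF assms] by blast+

lemma self_in_dyadic: "I \<in> dyadic I"
  unfolding dyadic_def by (rule UN_I[of 0]) auto

text \<open>Every finite family of dyadic intervals lives in finitely many generations, so the sums over the
first \<open>n\<close> generations are cofinal among all finite partial sums.\<close>

lemma infsum_dyadic_eq_SUP:
  fixes F :: "real set \<Rightarrow> ennreal"
  assumes "c < d"
  shows "infsum F (dyadic {c..<d}) = (SUP n. sum F (dyadic_below n {c..<d}))"
proof (rule antisym)
  have mono: "dyadic_below m I \<subseteq> dyadic_below n I" if "m \<le> n" for m n I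
    using that by (fastforce simp: dyadic_below_def)
  have ex: "\<exists>n. A \<subseteq> dyadic_below n {c..<d}" if "finite A" "A \<subseteq> dyadic {c..<d}" for A
    using that
  proof (induction A rule: finite_induct)
    case (insert J A)
    then obtain k n where "J \<in> dyadic_below k {c..<d}" "A \<subseteq> dyadic_below n {c..<d}"
      by (auto simp flip: UN_dyadic_below)
    then have "insert J A \<subseteq> dyadic_below (max k n) {c..<d}"
      using mono[of k "max k n"] mono[of n "max k n"] by force
    then show ?case ..
  qed auto
  show "infsum F (dyadic {c..<d}) \<le> (SUP n. sum F (dyadic_below n {c..<d}))"
    unfolding nonneg_infsum_complete[OF zero_le]
  proof (intro SUP_least)
    fix A assume "A \<in> {A. finite A \<and> A \<subseteq> dyadic {c..<d}}"
    with ex obtain n where "A \<subseteq> dyadic_below n {c..<d}" by blast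
    then have "sum F A \<le> sum F (dyadic_below n {c..<d})"
      by (intro sum_mono2 finite_dyadic_below assms) auto
    then show "sum F A \<le> (SUP n. sum F (dyadic_below n {c..<d}))"
      by (rule SUP_upper2[OF UNIV_I])
  qed
  show "(SUP n. sum F (dyadic_below n {c..<d})) \<le> infsum F (dyadic {c..<d})"
    unfolding nonneg_infsum_complete[OF zero_le]
    by (intro SUP_least SUP_upper) (use UN_dyadic_below finite_dyadic_below[OF assms] in auto)
qed

section \<open>The invariant and its two induction steps\<close>

lemma powr_minus_convex:
  fixes r :: real
  assumes "0 \<le> r"
  shows "convex_on {0<..} (\<lambda>x. x powr (- r))"
proof (rule f''_ge0_imp_convex)
  fix x :: real
  assume x: "x \<in> {0<..}"
  show "((\<lambda>x. x powr (- r)) has_real_derivative (- r) * x powr (- r - 1)) (at x)"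
    using x by (intro has_real_derivative_powr) auto
  show "((\<lambda>x. (- r) * x powr (- r - 1)) has_real_derivative
      (- r) * ((- r - 1) * x powr (- r - 1 - 1))) (at x)"
    using x by (intro DERIV_cmult has_real_derivative_powr) auto
  show "0 \<le> (- r) * ((- r - 1) * x powr (- r - 1 - 1))"
    using assms by (intro mult_nonpos_nonpos) (auto intro!: mult_nonpos_nonneg)
qed auto

text \<open>This is Jensen's inequality for \<open>x powr (- r)\<close> at the points \<open>X / m\<close> and \<open>X' / m'\<close>, weighted by the shares
of \<open>m\<close> and \<open>m'\<close> in their sum.\<close>

lemma powr_ratio_add_le:
  fixes r :: real
  assumes "0 \<le> r" "0 < m" "0 < m'" "0 < X" "0 < X'"
  shows "((m + m') / (X + X')) powr r \<le>
    m / (m + m') * (m / X) powr r + m' / (m + m') * (m' / X') powr r"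
proof -
  have *: "(u / v) powr r = (v / u) powr (- r)" if "0 < u" "0 < v" for u v :: real
    using that by (simp add: powr_minus powr_divide field_simps)
  have "(m / (m + m')) * (X / m) + (m' / (m + m')) * (X' / m') = (X + X') / (m + m')"
    using assms by (simp add: add_divide_distrib)
  moreover have "m / (m + m') = 1 - m' / (m + m')" using assms by (simp add: field_simps)
  ultimately show ?thesis
    using convex_onD[OF powr_minus_convex[OF assms(1)], of "m' / (m + m')" "X / m" "X' / m'"] assms
    by (simp add: *)
qed

text \<open>The arguments are a level \<open>l\<close>, the measure \<open>m\<close> of the superlevel set, the integral \<open>X\<close> and the Carleson
mass \<open>S\<close>, all belonging to one interval. They are not normalized by its length, so that the last three add up over
the two halves. The inequality is the weak-type bound with constant \<open>1 + 2 powr r / (2 powr r - 1)\<close>,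
strengthened by a second term that grows as the available Carleson mass shrinks.\<close>

definition level_bound :: "real \<Rightarrow> real \<Rightarrow> real \<Rightarrow> real \<Rightarrow> real \<Rightarrow> bool" where
  "level_bound r l m X S \<longleftrightarrow> (0 < m \<longrightarrow> 0 < X \<and> 0 < S \<and>
     l * (m / X) powr r + 2 powr r / (2 powr r - 1) * (m / S) powr r
       \<le> 1 + 2 powr r / (2 powr r - 1))"

lemma level_bound_mono:
  assumes "0 < r" "0 \<le> l" "level_bound r l m X S" "X \<le> X'" "S \<le> S'"
  shows "level_bound r l m X' S'"
  unfolding level_bound_def
proof (intro impI)
  assume m: "0 < m"
  define w where "w = 2 powr r / (2 powr r - 1)"
  have w: "0 < w" using assms(1) by (simp add: w_def)
  from assms(3) m have *: "0 < X" "0 < S" "l * (m / X) powr r + w * (m / S) powr r \<le> 1 + w"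
    by (auto simp: level_bound_def w_def)
  have "l * (m / X') powr r + w * (m / S') powr r \<le> l * (m / X) powr r + w * (m / S) powr r"
    using assms m * w by (intro add_mono mult_left_mono powr_mono2 divide_left_mono) auto
  with * assms show "0 < X' \<and> 0 < S' \<and> l * (m / X') powr r + 2 powr r / (2 powr r - 1) * (m / S') powr r
       \<le> 1 + 2 powr r / (2 powr r - 1)"
    unfolding w_def[symmetric] by linarith
qed

text \<open>This is midpoint concavity of the Bellman majorant, for two halves seen at the same level.\<close>

lemma level_bound_add:
  assumes "0 < r" "0 \<le> l" "0 \<le> m" "0 \<le> m'" "0 \<le> X" "0 \<le> X'" "0 \<le> S" "0 \<le> S'"
    and "level_bound r l m X S" "level_bound r l m' X' S'"
  shows "level_bound r l (m + m') (X + X') (S + S')"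
proof (cases "m = 0 \<or> m' = 0")
  case True
  then show ?thesis
    using level_bound_mono[OF assms(1,2,9), of "X + X'" "S + S'"]
      level_bound_mono[OF assms(1,2,10), of "X + X'" "S + S'"] assms by auto
next
  case False
  define w where "w = 2 powr r / (2 powr r - 1)"
  have w: "0 < w" using assms(1) by (simp add: w_def)
  from False assms have m: "0 < m" "0 < m'" by auto
  define u where "u = m / (m + m')"
  define u' where "u' = m' / (m + m')"
  have u: "0 \<le> u" "0 \<le> u'" "u + u' = 1"
    using m by (auto simp: u_def u'_def simp flip: add_divide_distrib)
  have *: "0 < X" "0 < S" "l * (m / X) powr r + w * (m / S) powr r \<le> 1 + w"
    using assms(9) m by (auto simp: level_bound_def w_def)
  have st': "0 < X'" "0 < S'" "l * (m' / X') powr r + w * (m' / S') powr r \<le> 1 + w"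
    using assms(10) m by (auto simp: level_bound_def w_def)
  have "l * ((m + m') / (X + X')) powr r + w * ((m + m') / (S + S')) powr r
      \<le> l * (u * (m / X) powr r + u' * (m' / X') powr r)
        + w * (u * (m / S) powr r + u' * (m' / S') powr r)"
    unfolding u_def u'_def using assms m * st' w
    by (intro add_mono mult_left_mono powr_ratio_add_le) auto
  also have "\<dots> = u * (l * (m / X) powr r + w * (m / S) powr r)
      + u' * (l * (m' / X') powr r + w * (m' / S') powr r)"
    by (simp add: algebra_simps)
  also have "\<dots> \<le> u * (1 + w) + u' * (1 + w)"
    by (intro add_mono mult_left_mono *(3) st'(3) u)
  also have "\<dots> = 1 + w" using u(3) by (metis distrib_right mult_1)
  finally show ?thesis using * st' unfolding level_bound_def w_def[symmetric] by auto
qed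

text \<open>Here the interval of length \<open>L\<close> itself is selected, which lowers the level that its halves must reach
by \<open>(X / L) powr r\<close> and raises the mass by \<open>L\<close>. Because \<open>(X / L) powr r * (m / X) powr r = (m / L) powr r\<close>, the claim
reduces, after division by \<open>(m / S) powr r\<close>, to \<open>(S / L) powr r + w * (S / (L + S)) powr r \<le> w\<close>. Its left side
increases with \<open>S\<close> and equals \<open>w\<close> at \<open>S = L\<close>. If the selected interval alone reaches the level, the halves
give no information, but then both terms are bounded directly, by \<open>1\<close> and \<open>w\<close>.\<close>

lemma level_bound_jump:
  assumes "0 < r" "0 < L" "0 \<le> m" "0 < l" "0 \<le> S" "S \<le> L"
    and "m \<le> L" "0 \<le> X"
    and "level_bound r (l - (X / L) powr r) m X S \<or> l \<le> (X / L) powr r"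
  shows "level_bound r l m X (L + S)"
  unfolding level_bound_def
proof (intro impI)
  assume m: "0 < m"
  define w where "w = 2 powr r / (2 powr r - 1)"
  have w: "0 < w" using assms(1) by (simp add: w_def)
  have "1 < (2::real) powr r" using assms(1) by simp
  \<comment> \<open>the equation that determines the constant: the case \<open>S = L\<close> below is tight\<close>
  then have w1: "1 + w * (1 / 2) powr r = w"
    using assms(1) unfolding w_def powr_divide by (simp add: divide_simps)
  have XL: "(X / L) powr r * (m / X) powr r = (m / L) powr r" if "0 < X"
  proof -
    have "X / L * (m / X) = m / L" using that by simp
    then show ?thesis by (simp only: powr_mult[symmetric])
  qed
  have goal: "0 < X \<and> l * (m / X) powr r + w * (m / (L + S)) powr r \<le> 1 + w"
  proof (cases "l \<le> (X / L) powr r")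
    case True
    with assms have X: "0 < X" by (cases "X = 0") auto
    have "l * (m / X) powr r \<le> (m / L) powr r"
      unfolding XL[OF X, symmetric] using True by (intro mult_right_mono) auto
    also have "\<dots> \<le> 1" using m assms by (intro powr_le1) auto
    finally have 1: "l * (m / X) powr r \<le> 1" .
    have "(m / (L + S)) powr r \<le> 1" using m assms by (intro powr_le1) auto
    then have "w * (m / (L + S)) powr r \<le> w" using w by simp
    with 1 X show ?thesis by simp
  next
    case False
    with assms(9) m have *: "0 < X" "0 < S"
      "(l - (X / L) powr r) * (m / X) powr r + w * (m / S) powr r \<le> 1 + w"
      by (auto simp: level_bound_def w_def)
    have "(m / L) powr r = (m / S) powr r * (S / L) powr r"
      "(m / (L + S)) powr r = (m / S) powr r * (S / (L + S)) powr r"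
      unfolding powr_mult[symmetric] using * by simp_all
    then have eq: "(m / L) powr r + w * (m / (L + S)) powr r =
        (m / S) powr r * ((S / L) powr r + w * (S / (L + S)) powr r)"
      by (simp add: distrib_left)
    have "(S / L) powr r \<le> 1" using * assms by (intro powr_le1) auto
    moreover have "(S / (L + S)) powr r \<le> (1 / 2) powr r"
      using * assms by (intro powr_mono2) (auto simp: field_simps)
    then have "w * (S / (L + S)) powr r \<le> w * (1 / 2) powr r" using w by simp
    ultimately have "(S / L) powr r + w * (S / (L + S)) powr r \<le> w" using w1 by linarith
    then have "(m / L) powr r + w * (m / (L + S)) powr r \<le> (m / S) powr r * w"
      unfolding eq by (intro mult_left_mono) auto
    moreover have "(l - (X / L) powr r) * (m / X) powr r = l * (m / X) powr r - (m / L) powr r"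
      using XL[OF *(1)] by (simp add: left_diff_distrib)
    ultimately show ?thesis using * by (simp add: mult.commute)
  qed
  then show "0 < X \<and> 0 < L + S \<and> l * (m / X) powr r + 2 powr r / (2 powr r - 1) * (m / (L + S)) powr r
       \<le> 1 + 2 powr r / (2 powr r - 1)"
    using assms unfolding w_def[symmetric] by auto
qed

section \<open>The upper bound\<close>

text \<open>The argument \<open>g\<close> stands for \<open>\<bar>f\<bar> powr p\<close> and \<open>r\<close> for \<open>1 / p\<close>; the values are real because only finitely
many generations contribute.\<close>

definition trunc_op ::
    "nat \<Rightarrow> real set \<Rightarrow> (real set \<Rightarrow> real) \<Rightarrow> real \<Rightarrow> (real \<Rightarrow> real) \<Rightarrow> real \<Rightarrow> real" where
  "trunc_op n I \<alpha> r g t = (\<Sum>J\<in>dyadic_below n I. \<alpha> J * avg g J powr r * indicator J t)"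

lemma trunc_op_measurable:
  assumes "c < d"
  shows "trunc_op n {c..<d} \<alpha> r g \<in> borel_measurable borel"
  unfolding trunc_op_def
  by (intro borel_measurable_sum borel_measurable_times borel_measurable_const borel_measurable_indicator)
    (use assms in \<open>auto elim: dyadic_belowE\<close>)

lemma trunc_op_superlevel_lmeasurable:
  assumes "c < d"
  shows "{t \<in> {c..<d}. l \<le> trunc_op n {c..<d} \<alpha> r g t} \<in> lmeasurable"
proof (rule bounded_set_imp_lmeasurable)
  show "bounded {t \<in> {c..<d}. l \<le> trunc_op n {c..<d} \<alpha> r g t}"
    by (rule bounded_subset[of "{c..d}"]) auto
  note [measurable] = trunc_op_measurable[OF assms]
  have "{t \<in> {c..<d}. l \<le> trunc_op n {c..<d} \<alpha> r g t} \<in> sets borel"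
    by measurable
  then show "{t \<in> {c..<d}. l \<le> trunc_op n {c..<d} \<alpha> r g t} \<in> sets lebesgue"
    by simp
qed

lemma trunc_op_outside:
  assumes "c < d" "t \<notin> {c..<d}"
  shows "trunc_op n {c..<d} \<alpha> r g t = 0"
  unfolding trunc_op_def
proof (rule sum.neutral, rule)
  fix J assume "J \<in> dyadic_below n {c..<d}"
  then obtain u v where "J = {u..<v}" "c \<le> u" "v \<le> d" using assms by (auto elim: dyadic_belowE)
  with assms show "\<alpha> J * avg g J powr r * indicator J t = 0" by auto
qed

text \<open>Induction on the number of generations, for all intervals and all levels at once: on each half of
\<open>I\<close> the operator differs from the one of that half by the constant \<open>h\<close> contributed by \<open>I\<close>, so the
superlevel set is the disjoint union of those of the halves at the level \<open>l - h\<close>.\<close>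

lemma level_bound_trunc_op:
  assumes "c < d" "0 < r" "0 < l" "\<And>t. 0 \<le> g t" "set_integrable lebesgue {c..<d} g"
    and "\<And>J. J \<in> dyadic {c..<d} \<Longrightarrow> \<alpha> J \<in> {0, 1}"
    and "\<And>J n. J \<in> dyadic {c..<d} \<Longrightarrow>
      (\<Sum>K\<in>dyadic_below n J. \<alpha> K * measure lebesgue K) \<le> 2 * measure lebesgue J"
  shows "level_bound r l (measure lebesgue {t \<in> {c..<d}. l \<le> trunc_op n {c..<d} \<alpha> r g t})
    (LINT t:{c..<d}|lebesgue. g t) (\<Sum>K\<in>dyadic_below n {c..<d}. \<alpha> K * measure lebesgue K)"
  using assms
proof (induction n arbitrary: c d l)
  case 0
  then show ?case by (simp add: trunc_op_def dyadic_below_def level_bound_def)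
next
  case (Suc n)
  note r = \<open>0 < r\<close> and l = \<open>0 < l\<close> and g = Suc.prems(4) and alpha = Suc.prems(6) and carl = Suc.prems(7)
  define e where "e = (c + d) / 2"
  have e: "c < e" "e < d" using Suc.prems(1) by (auto simp: e_def)
  have half: "dyadic {c..<e} \<subseteq> dyadic {c..<d}" "dyadic {e..<d} \<subseteq> dyadic {c..<d}"
    using dyadic_half_subset[OF Suc.prems(1)] by (auto simp: e_def)
  define X where "X a b = (LINT t:{a..<b}|lebesgue. g t)" for a b
  define S where "S n a b = (\<Sum>K\<in>dyadic_below n {a..<b}. \<alpha> K * measure lebesgue K)" for n and a b :: real
  define E where "E n l a b = {t \<in> {a..<b}. l \<le> trunc_op n {a..<b} \<alpha> r g t}" for n l a b
  define h where "h = \<alpha> {c..<d} * (X c d / (d - c)) powr r"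
  have X0: "0 \<le> X a b" for a b
    unfolding X_def set_lebesgue_integral_def using g by (intro integral_nonneg_AE) auto
  have intl: "set_integrable lebesgue {c..<e} g" "set_integrable lebesgue {e..<d} g"
    by (rule set_integrable_subset[OF Suc.prems(5)]; use e in auto)+
  have "X c e + X e d = (LINT t:{c..<e} \<union> {e..<d}|lebesgue. g t)"
    unfolding X_def by (rule set_integral_Un[symmetric]) (use intl in auto)
  moreover have "{c..<e} \<union> {e..<d} = {c..<d}" using e by auto
  ultimately have X: "X c d = X c e + X e d" by (simp add: X_def)
  have S0: "0 \<le> S n a b" if "a < b" "dyadic {a..<b} \<subseteq> dyadic {c..<d}" for a b
    unfolding S_def
  proof (intro sum_nonneg mult_nonneg_nonneg)
    fix K assume "K \<in> dyadic_below n {a..<b}"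
    then have "K \<in> dyadic {c..<d}" using that unfolding UN_dyadic_below[symmetric] by blast
    then show "0 \<le> \<alpha> K" using alpha[of K] by auto
  qed auto
  have S: "S (Suc n) c d = \<alpha> {c..<d} * (d - c) + (S n c e + S n e d)"
    unfolding S_def e_def using Suc.prems(1) by (subst sum_dyadic_below_Suc) auto
  have Top: "trunc_op (Suc n) {c..<d} \<alpha> r g t =
      h + (trunc_op n {c..<e} \<alpha> r g t + trunc_op n {e..<d} \<alpha> r g t)" if "t \<in> {c..<d}" for t
    using that Suc.prems(1)
    unfolding trunc_op_def e_def sum_dyadic_below_Suc[OF Suc.prems(1)]
    by (simp add: h_def avg_def X_def)
  have E: "E (Suc n) l c d = E n (l - h) c e \<union> E n (l - h) e d"
  proof (rule set_eqI)
    fix t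
    have "trunc_op n {e..<d} \<alpha> r g t = 0" if "t < e"
      using that e by (intro trunc_op_outside) auto
    moreover have "trunc_op n {c..<e} \<alpha> r g t = 0" if "\<not> t < e"
      using that e by (intro trunc_op_outside) auto
    ultimately show "t \<in> E (Suc n) l c d \<longleftrightarrow> t \<in> E n (l - h) c e \<union> E n (l - h) e d"
      using e by (cases "t < e") (auto simp: E_def Top)
  qed
  have meas: "E n l a b \<in> lmeasurable" if "a < b" for n l a b
    unfolding E_def by (rule trunc_op_superlevel_lmeasurable[OF that])
  have m: "measure lebesgue (E (Suc n) l c d) =
      measure lebesgue (E n (l - h) c e) + measure lebesgue (E n (l - h) e d)"
    unfolding E using meas e by (intro measure_Un2[THEN trans]) (auto simp: E_def intro!: arg_cong[where f="measure lebesgue"])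
  have mL: "measure lebesgue (E (Suc n) l c d) \<le> d - c"
  proof -
    have "{c..<d} \<in> lmeasurable" by (intro bounded_set_imp_lmeasurable) auto
    then have "measure lebesgue (E (Suc n) l c d) \<le> measure lebesgue {c..<d}"
      using meas[OF Suc.prems(1)] by (intro measure_mono_fmeasurable) (auto simp: E_def)
    then show ?thesis using Suc.prems(1) by simp
  qed
  have both: "level_bound r (l - h) (measure lebesgue (E (Suc n) l c d)) (X c d) (S n c e + S n e d)"
    if "0 < l - h"
  proof -
    have "level_bound r (l - h) (measure lebesgue (E n (l - h) c e)) (X c e) (S n c e)"
      unfolding E_def X_def S_def
      by (rule Suc.IH) (use e r that g intl alpha carl half in blast)+
    moreover have "level_bound r (l - h) (measure lebesgue (E n (l - h) e d)) (X e d) (S n e d)"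
      unfolding E_def X_def S_def
      by (rule Suc.IH) (use e r that g intl alpha carl half in blast)+
    ultimately show ?thesis
      unfolding m X using r that X0 S0 e half by (intro level_bound_add) auto
  qed
  have "level_bound r l (measure lebesgue (E (Suc n) l c d)) (X c d) (S (Suc n) c d)"
  proof (cases "\<alpha> {c..<d} = 0")
    case True
    then show ?thesis using both l by (simp add: h_def S)
  next
    case False
    then have a1: "\<alpha> {c..<d} = 1" using alpha[OF self_in_dyadic] by auto
    have "S (Suc n) c d \<le> 2 * (d - c)"
      using carl[OF self_in_dyadic, of "Suc n"] Suc.prems(1) by (simp add: S_def)
    then have SL: "S n c e + S n e d \<le> d - c" by (simp add: S a1)
    have "level_bound r l (measure lebesgue (E (Suc n) l c d)) (X c d) ((d - c) + (S n c e + S n e d))"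
      using r l Suc.prems(1) SL S0 e half mL X0 both
      by (intro level_bound_jump) (auto simp: h_def a1 not_less intro: add_nonneg_nonneg)
    then show ?thesis by (simp add: S a1)
  qed
  then show ?case by (simp add: E_def X_def S_def)
qed

text \<open>Dropping the nonnegative mass term leaves the weak-type inequality, here in the form without roots.\<close>

lemma level_bound_imp_weak_type:
  assumes "0 < r" "0 \<le> l" "0 \<le> m" "0 \<le> X" "level_bound r l m X S"
  shows "l powr (1 / r) * m \<le> (1 + 2 powr r / (2 powr r - 1)) powr (1 / r) * X"
proof (cases "m = 0")
  case True
  then show ?thesis using assms by simp
next
  case False
  define w where "w = 2 powr r / (2 powr r - 1)"
  have w: "0 < w" using assms(1) by (simp add: w_def)
  from False assms have *: "0 < X" "l * (m / X) powr r + w * (m / S) powr r \<le> 1 + w"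
    by (auto simp: level_bound_def w_def)
  moreover have "0 \<le> w * (m / S) powr r" using w by simp
  ultimately have "l * (m / X) powr r \<le> 1 + w" by linarith
  then have "(l * (m / X) powr r) powr (1 / r) \<le> (1 + w) powr (1 / r)"
    using assms by (intro powr_mono2) auto
  also have "(l * (m / X) powr r) powr (1 / r) = l powr (1 / r) * (m / X)"
    using assms * by (simp add: powr_mult powr_powr)
  finally show ?thesis using *(1) by (simp add: field_simps w_def)
qed

lemma carleson2_nonneg: "\<alpha> \<in> carleson2 I \<Longrightarrow> J \<in> dyadic I \<Longrightarrow> 0 \<le> \<alpha> J"
  by (fastforce simp: carleson2_def adapted_binary_def)

text \<open>The Carleson condition enters the induction only through finite partial sums.\<close>

lemma carleson2_sum_le:
  assumes "a < b" "\<alpha> \<in> carleson2 {a..<b}" "J \<in> dyadic {a..<b}"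
  shows "(\<Sum>K\<in>dyadic_below n J. \<alpha> K * measure lebesgue K) \<le> 2 * measure lebesgue J"
proof -
  obtain k where k: "J \<in> dyadic_gen k {a..<b}" using assms(3) by (auto simp: dyadic_def)
  obtain u v where J: "J = {u..<v}" "u < v" using dyadic_genE[OF k assms(1)] by metis
  have sub: "dyadic J \<subseteq> dyadic {a..<b}"
  proof -
    have "dyadic_gen m J \<subseteq> dyadic_gen (k + m) {a..<b}" for m
    proof (induction m)
      case 0
      then show ?case using k by simp
    next
      case (Suc m)
      then show ?case unfolding add_Suc_right dyadic_gen.simps by blast
    qed
    then show ?thesis unfolding dyadic_def by blast
  qed
  have L: "0 < measure lebesgue J" using J by simp
  have nn: "0 \<le> \<alpha> K * measure lebesgue K" if "K \<in> dyadic J" for K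
    using carleson2_nonneg[OF assms(2)] sub that by (intro mult_nonneg_nonneg) auto
  have "carleson_avg \<alpha> J \<le> 2"
    using assms(2,3) unfolding carleson2_def by (auto simp: SUP_le_iff)
  then have "carleson_avg \<alpha> J * ennreal (measure lebesgue J) \<le> 2 * ennreal (measure lebesgue J)"
    by (intro mult_right_mono) auto
  also have "carleson_avg \<alpha> J * ennreal (measure lebesgue J) =
      (\<Sum>\<^sub>\<infinity>K\<in>dyadic J. ennreal (\<alpha> K * measure lebesgue K))"
    unfolding carleson_avg_def ennreal_divide_times using L by simp
  finally have le: "(\<Sum>\<^sub>\<infinity>K\<in>dyadic J. ennreal (\<alpha> K * measure lebesgue K)) \<le> 2 * ennreal (measure lebesgue J)" .
  have "ennreal (\<Sum>K\<in>dyadic_below n J. \<alpha> K * measure lebesgue K) =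
      (\<Sum>K\<in>dyadic_below n J. ennreal (\<alpha> K * measure lebesgue K))"
    using nn dyadic_below_subset by (subst sum_ennreal) auto
  also have "\<dots> \<le> (\<Sum>\<^sub>\<infinity>K\<in>dyadic J. ennreal (\<alpha> K * measure lebesgue K))"
    unfolding J(1) infsum_dyadic_eq_SUP[OF J(2)] by (intro SUP_upper) auto
  also have "\<dots> \<le> ennreal (2 * measure lebesgue J)"
    using le by (simp add: ennreal_mult)
  finally show ?thesis using L by (simp add: ennreal_le_iff)
qed

lemma sparse_op_eq_SUP:
  assumes "a < b" "\<alpha> \<in> carleson2 {a..<b}"
  shows "sparse_op {a..<b} \<alpha> p f t =
    (SUP n. ennreal (trunc_op n {a..<b} \<alpha> (1 / p) (\<lambda>s. \<bar>f s\<bar> powr p) t))"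
proof -
  have "(\<Sum>J\<in>dyadic_below n {a..<b}.
      ennreal (\<alpha> J * avg (\<lambda>s. \<bar>f s\<bar> powr p) J powr (1 / p) * indicator J t)) =
      ennreal (trunc_op n {a..<b} \<alpha> (1 / p) (\<lambda>s. \<bar>f s\<bar> powr p) t)" for n
    unfolding trunc_op_def using carleson2_nonneg[OF assms(2)] dyadic_below_subset
    by (intro sum_ennreal) (auto intro!: mult_nonneg_nonneg)
  then show ?thesis
    unfolding sparse_op_def infsum_dyadic_eq_SUP[OF assms(1)] by simp
qed

lemma trunc_op_mono:
  assumes "a < b" "\<And>J. J \<in> dyadic {a..<b} \<Longrightarrow> 0 \<le> \<alpha> J" "m \<le> n"
  shows "trunc_op m {a..<b} \<alpha> r g t \<le> trunc_op n {a..<b} \<alpha> r g t"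
  unfolding trunc_op_def
proof (rule sum_mono2)
  show "dyadic_below m {a..<b} \<subseteq> dyadic_below n {a..<b}"
    using assms(3) by (fastforce simp: dyadic_below_def)
  fix J assume "J \<in> dyadic_below n {a..<b} - dyadic_below m {a..<b}"
  then show "0 \<le> \<alpha> J * avg g J powr r * indicator J t"
    using assms(2) dyadic_below_subset by (intro mult_nonneg_nonneg) auto
qed (use assms finite_dyadic_below in auto)

lemma sparse_op_superlevel_lmeasurable:
  assumes "a < b" "\<alpha> \<in> carleson2 {a..<b}"
  shows "{t \<in> {a..<b}. l \<le> sparse_op {a..<b} \<alpha> p f t} \<in> lmeasurable"
proof (rule bounded_set_imp_lmeasurable)
  show "bounded {t \<in> {a..<b}. l \<le> sparse_op {a..<b} \<alpha> p f t}"
    by (rule bounded_subset[of "{a..b}"]) auto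
  note [measurable] = trunc_op_measurable[OF assms(1)]
  have "{t \<in> {a..<b}. l \<le> sparse_op {a..<b} \<alpha> p f t} \<in> sets borel"
    unfolding sparse_op_eq_SUP[OF assms] by measurable
  then show "{t \<in> {a..<b}. l \<le> sparse_op {a..<b} \<alpha> p f t} \<in> sets lebesgue"
    by simp
qed

text \<open>A point where the full operator reaches \<open>l\<close> need not have a truncation reaching \<open>l\<close>, but at every
level \<open>l' < l\<close> some truncation does. The bound is therefore proved at such \<open>l'\<close>, and \<open>l' \<rightarrow> l\<close>
at the end.\<close>

lemma sparse_op_weak_type:
  assumes "a < b" "0 < p" "\<alpha> \<in> carleson2 {a..<b}" "0 < l"
    and int: "set_integrable lebesgue {a..<b} (\<lambda>t. \<bar>f t\<bar> powr p)"
  shows "l powr p * measure lebesgue {t \<in> {a..<b}. ennreal l \<le> sparse_op {a..<b} \<alpha> p f t}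
    \<le> (1 + 2 powr (1 / p) / (2 powr (1 / p) - 1)) powr p * (LINT t:{a..<b}|lebesgue. \<bar>f t\<bar> powr p)"
    (is "l powr p * measure lebesgue ?E \<le> ?C * ?X")
proof (rule field_le_mult_one_interval)
  fix z :: real
  assume z: "0 < z" "z < 1"
  define g where "g = (\<lambda>t. \<bar>f t\<bar> powr p)"
  \<comment> \<open>chosen so that \<open>l' powr p = z * l powr p\<close>, which turns the limit \<open>l' \<rightarrow> l\<close> into \<open>z \<rightarrow> 1\<close>\<close>
  define l' where "l' = z powr (1 / p) * l"
  have "z powr (1 / p) < 1 powr (1 / p)" using z assms(2) by (intro powr_less_mono2) auto
  then have l': "0 < l'" "l' < l" using z assms(4) by (auto simp: l'_def)
  have l'p: "l' powr p = z * l powr p"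
    using z assms(2,4) by (simp add: l'_def powr_mult powr_powr)
  define A where "A n = {t \<in> {a..<b}. l' \<le> trunc_op n {a..<b} \<alpha> (1 / p) g t}" for n
  have A: "A n \<in> lmeasurable" for n
    unfolding A_def by (rule trunc_op_superlevel_lmeasurable[OF assms(1)])
  have UA: "(\<Union>n. A n) \<in> lmeasurable"
    by (rule bounded_set_imp_lmeasurable, rule bounded_subset[of "{a..b}"])
      (use A in \<open>auto simp: A_def\<close>)
  have "incseq A"
  proof (rule incseq_SucI)
    fix n
    have "trunc_op n {a..<b} \<alpha> (1 / p) g t \<le> trunc_op (Suc n) {a..<b} \<alpha> (1 / p) g t" for t
      by (rule trunc_op_mono) (use assms carleson2_nonneg in auto)
    then show "A n \<subseteq> A (Suc n)" by (auto simp: A_def intro: order_trans)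
  qed
  then have lim: "(\<lambda>n. measure lebesgue (A n)) \<longlonglongrightarrow> measure lebesgue (\<Union>n. A n)"
    using A UA by (intro Lim_measure_incseq) (auto simp: fmeasurable_def)
  have "l' powr p * measure lebesgue (A n) \<le> ?C * ?X" for n
  proof -
    have "level_bound (1 / p) l' (measure lebesgue (A n)) (LINT t:{a..<b}|lebesgue. g t)
        (\<Sum>K\<in>dyadic_below n {a..<b}. \<alpha> K * measure lebesgue K)"
      unfolding A_def
    proof (rule level_bound_trunc_op)
      show "\<alpha> J \<in> {0, 1}" if "J \<in> dyadic {a..<b}" for J
        using assms(3) that by (auto simp: carleson2_def adapted_binary_def)
    qed (use assms l' carleson2_sum_le in \<open>auto simp: g_def\<close>)
    moreover have "0 \<le> (LINT t:{a..<b}|lebesgue. g t)"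
      unfolding set_lebesgue_integral_def by (intro integral_nonneg_AE) (auto simp: g_def)
    ultimately show ?thesis
      using level_bound_imp_weak_type[of "1 / p" l' "measure lebesgue (A n)"] assms(2) l'
      by (simp add: g_def)
  qed
  then have "l' powr p * measure lebesgue (\<Union>n. A n) \<le> ?C * ?X"
    by (intro LIMSEQ_le_const2[OF tendsto_mult_left[OF lim]]) auto
  moreover have "measure lebesgue ?E \<le> measure lebesgue (\<Union>n. A n)"
  proof (rule measure_mono_fmeasurable[OF _ _ UA])
    show "?E \<subseteq> (\<Union>n. A n)"
    proof
      fix t assume t: "t \<in> ?E"
      have "ennreal l' < ennreal l" using l' by (simp add: ennreal_lessI)
      also have "\<dots> \<le> (SUP n. ennreal (trunc_op n {a..<b} \<alpha> (1 / p) g t))"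
        using t by (simp add: sparse_op_eq_SUP[OF assms(1,3)] g_def)
      finally obtain n where "ennreal l' < ennreal (trunc_op n {a..<b} \<alpha> (1 / p) g t)"
        by (auto simp: less_SUP_iff)
      then have "l' < trunc_op n {a..<b} \<alpha> (1 / p) g t" using l' by (simp add: ennreal_less_iff)
      with t show "t \<in> (\<Union>n. A n)" by (auto simp: A_def intro: less_imp_le)
    qed
    show "?E \<in> sets lebesgue"
      using sparse_op_superlevel_lmeasurable[OF assms(1,3)] by (auto simp: fmeasurable_def)
  qed
  then have "l' powr p * measure lebesgue ?E \<le> l' powr p * measure lebesgue (\<Union>n. A n)"
    by (intro mult_left_mono) auto
  ultimately show "z * (l powr p * measure lebesgue ?E) \<le> ?C * ?X"
    by (simp add: l'p mult.assoc)
qed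

lemma weak_norm_le:
  assumes "a < b" "0 < p" "\<alpha> \<in> carleson2 {a..<b}"
  shows "weak_norm {a..<b} \<alpha> p \<le> ennreal (1 + 2 powr (1 / p) / (2 powr (1 / p) - 1))"
  unfolding weak_norm_def
proof (rule SUP_least, clarify)
  fix f :: "real \<Rightarrow> real" and l :: real
  assume f: "f \<in> Lp_on p {a..<b}" and pos: "\<forall>t\<in>{a..<b}. 0 \<le> f t"
    and avg: "0 < avg (\<lambda>t. f t powr p) {a..<b}" and l: "0 < l"
  define m where "m = measure lebesgue {t \<in> {a..<b}. ennreal l \<le> sparse_op {a..<b} \<alpha> p f t}"
  define X where "X = (LINT t:{a..<b}|lebesgue. \<bar>f t\<bar> powr p)"
  define C where "C = 1 + 2 powr (1 / p) / (2 powr (1 / p) - 1)"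
  have C: "0 < C" using assms(2) unfolding C_def by (intro add_pos_pos divide_pos_pos) auto
  have int: "set_integrable lebesgue {a..<b} (\<lambda>t. \<bar>f t\<bar> powr p)"
    using f by (simp add: Lp_on_def set_integrable_def integrable_restrict_space)
  have "(LINT t:{a..<b}|lebesgue. f t powr p) = X"
    unfolding X_def using pos by (intro set_lebesgue_integral_cong) auto
  then have av: "avg (\<lambda>t. f t powr p) {a..<b} = X / (b - a)"
    using assms(1) by (simp add: avg_def)
  with avg assms(1) have X: "0 < X" by (simp add: zero_less_divide_iff)
  have "l powr p * m \<le> C powr p * X"
    unfolding m_def X_def C_def by (rule sparse_op_weak_type) (use assms l int in auto)
  then have "l powr p * m / X \<le> C powr p" using X by (simp add: field_simps)
  then have "(l powr p * m / X) powr (1 / p) \<le> (C powr p) powr (1 / p)"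
    using assms(2) X by (intro powr_mono2) (auto simp: m_def)
  also have "\<dots> = C" using C assms(2) by (simp add: powr_powr)
  finally show "ennreal ((l powr p / avg (\<lambda>t. f t powr p) {a..<b} * (1 / measure lebesgue {a..<b}) *
      measure lebesgue {t \<in> {a..<b}. ennreal l \<le> sparse_op {a..<b} \<alpha> p f t}) powr (1 / p))
      \<le> ennreal (1 + 2 powr (1 / p) / (2 powr (1 / p) - 1))"
    using assms(1) X unfolding av m_def[symmetric] C_def[symmetric]
    by (intro ennreal_leI) simp
qed

section \<open>The extremal sequence\<close>

definition left_dyadic :: "real \<Rightarrow> real \<Rightarrow> nat \<Rightarrow> real set" where
  "left_dyadic a b j = {a..<a + (b - a) / 2 ^ j}"

definition last_right_half :: "real \<Rightarrow> real \<Rightarrow> nat \<Rightarrow> real set" where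
  "last_right_half a b n = {a + (b - a) / 2 ^ Suc n..<a + (b - a) / 2 ^ n}"

definition left_chain :: "real \<Rightarrow> real \<Rightarrow> nat \<Rightarrow> real set set" where
  "left_chain a b n = left_dyadic a b ` {..Suc n} \<union> {last_right_half a b n}"

lemma finite_left_chain: "finite (left_chain a b n)"
  by (simp add: left_chain_def)

lemma
  assumes "a < b"
  shows measure_left_dyadic: "measure lebesgue (left_dyadic a b j) = (b - a) / 2 ^ j"
    and measure_last_right_half: "measure lebesgue (last_right_half a b n) = (b - a) / 2 ^ Suc n"
proof -
  show "measure lebesgue (left_dyadic a b j) = (b - a) / 2 ^ j"
    using assms by (simp add: left_dyadic_def)
  have "(b - a) / 2 ^ Suc n \<le> (b - a) / 2 ^ n" using assms by (simp add: field_simps)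
  then show "measure lebesgue (last_right_half a b n) = (b - a) / 2 ^ Suc n"
    using assms by (simp add: last_right_half_def field_simps)
qed

lemma left_chain_subset_dyadic:
  assumes "a < b"
  shows "left_chain a b n \<subseteq> dyadic {a..<b}"
proof -
  have mid: "(a + (a + (b - a) / 2 ^ j)) / 2 = a + (b - a) / 2 ^ Suc j" for j
    by (simp add: field_simps)
  have lt: "a < a + (b - a) / 2 ^ j" for j using assms by simp
  have gen: "left_dyadic a b j \<in> dyadic_gen j {a..<b}" for j
  proof (induction j)
    case 0
    then show ?case by (simp add: left_dyadic_def)
  next
    case (Suc j)
    show ?case
      unfolding dyadic_gen.simps mem_Collect_eq
      by (rule exI[of _ a], rule exI[of _ "a + (b - a) / 2 ^ j"])
        (unfold mid, use Suc lt[of j] in \<open>simp add: left_dyadic_def del: power_Suc\<close>)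
  qed
  have "last_right_half a b n \<in> dyadic_gen (Suc n) {a..<b}"
    unfolding dyadic_gen.simps mem_Collect_eq
    by (rule exI[of _ a], rule exI[of _ "a + (b - a) / 2 ^ n"])
      (unfold mid, use gen[of n] lt[of n] in \<open>simp add: left_dyadic_def last_right_half_def del: power_Suc\<close>)
  with gen show ?thesis unfolding left_chain_def dyadic_def by blast
qed

text \<open>If \<open>J\<close> starts at \<open>a\<close>, it is the left interval of some generation \<open>m\<close>, and the members below it form a
geometric progression whose last term occurs twice: this makes the sum at most \<open>2 * \<bar>J\<bar>\<close>, with equality for
\<open>m \<le> n\<close>. Any other \<open>J\<close> contains at most one member, the last right half.\<close>

lemma left_chain_sum_le:
  assumes "a < b" "J \<in> dyadic {a..<b}"
  shows "(\<Sum>K | K \<in> left_chain a b n \<and> K \<subseteq> J. measure lebesgue K) \<le> 2 * measure lebesgue J"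
    (is "sum _ ?D \<le> _")
proof -
  define L where "L = b - a"
  have L: "0 < L" using assms by (simp add: L_def)
  obtain m where "J \<in> dyadic_gen m {a..<b}" using assms(2) by (auto simp: dyadic_def)
  then obtain u v where J: "J = {u..<v}" "u < v" "a \<le> u" "v - u = L / 2 ^ m"
    using dyadic_genE[OF _ assms(1)] unfolding L_def by metis
  have mJ: "measure lebesgue J = v - u" using J by simp
  show ?thesis
  proof (cases "u = a")
    case False
    have "K = last_right_half a b n" if K: "K \<in> ?D" for K
    proof -
      have "a \<notin> K" using K False J(1,3) by auto
      moreover have "a \<in> left_dyadic a b j" for j using assms by (simp add: left_dyadic_def)
      ultimately show ?thesis using K by (auto simp: left_chain_def)
    qed
    then have "?D = {} \<or> ?D = {last_right_half a b n} \<and> last_right_half a b n \<subseteq> J" by blast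
    then show ?thesis
    proof (elim disjE conjE)
      assume D: "?D = {last_right_half a b n}" and sub: "last_right_half a b n \<subseteq> J"
      have "measure lebesgue (last_right_half a b n) \<le> measure lebesgue J"
        by (intro measure_mono_fmeasurable bounded_set_imp_lmeasurable sub)
          (auto simp: last_right_half_def J(1))
      then show ?thesis unfolding D by (simp add: order_trans[OF _ mult_right_mono[of 1 2]])
    next
      assume D: "?D = {}"
      show ?thesis unfolding D by simp
    qed
  next
    case True
    then have v: "v = a + L / 2 ^ m" using J by simp
    have scale: "m \<le> j" if "L / 2 ^ j \<le> L / 2 ^ m" for j
    proof (rule ccontr)
      assume "\<not> m \<le> j"
      then have "(2::real) ^ j < 2 ^ m" by simp
      then have "L / 2 ^ m < L / 2 ^ j" using L by (intro divide_strict_left_mono) auto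
      with that show False by simp
    qed
    have pos: "\<not> L / 2 ^ j \<le> 0" for j using L by (simp add: not_le)
    have chain: "m \<le> j" if "left_dyadic a b j \<subseteq> J" for j
      using that L unfolding J(1) v True left_dyadic_def L_def[symmetric]
      by (intro scale) (simp add: pos)
    have sib: "m \<le> n" if "last_right_half a b n \<subseteq> J"
    proof -
      have "L / 2 ^ Suc n < L / 2 ^ n" using L by (simp add: field_simps)
      then show ?thesis
        using that L unfolding J(1) v True last_right_half_def L_def[symmetric]
        by (intro scale) (simp add: not_le)
    qed
    show ?thesis
    proof (cases "m \<le> Suc n")
      case True
      have "(\<Sum>j = m..m + k. L / 2 ^ j) + L / 2 ^ (m + k) = 2 * (L / 2 ^ m)" for k
        by (induction k) simp_all
      from this[of "Suc n - m"] True
      have geo: "(\<Sum>j = m..Suc n. L / 2 ^ j) + L / 2 ^ Suc n = 2 * (L / 2 ^ m)" by simp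
      have "sum (measure lebesgue) ?D
          \<le> sum (measure lebesgue) (left_dyadic a b ` {m..Suc n} \<union> {last_right_half a b n})"
        using chain by (intro sum_mono2) (auto simp: left_chain_def)
      also have "\<dots> \<le> sum (measure lebesgue) (left_dyadic a b ` {m..Suc n})
          + sum (measure lebesgue) {last_right_half a b n}"
        by (simp add: sum.insert_if del: sum.cl_ivl_Suc)
      also have "\<dots> \<le> (\<Sum>j = m..Suc n. measure lebesgue (left_dyadic a b j))
          + measure lebesgue (last_right_half a b n)"
        by (intro add_mono order_refl sum_image_le[THEN order_trans]) (auto simp: o_def)
      also have "\<dots> = 2 * (L / 2 ^ m)"
        unfolding measure_left_dyadic[OF assms(1)] measure_last_right_half[OF assms(1)] L_def[symmetric]
        by (rule geo)
      finally show ?thesis using mJ J(4) by simp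
    next
      case False
      have "?D = {}"
      proof (rule equals0I)
        fix K assume "K \<in> ?D"
        then show False using chain sib False by (fastforce simp: left_chain_def)
      qed
      then show ?thesis by (simp only: sum.empty) simp
    qed
  qed
qed

lemma indicator_left_chain_carleson2:
  assumes "a < b"
  shows "indicator (left_chain a b n) \<in> carleson2 {a..<b}"
  unfolding carleson2_def mem_Collect_eq
proof
  show "adapted_binary {a..<b} (indicator (left_chain a b n))"
    by (simp add: adapted_binary_def indicator_def)
  show "(SUP J\<in>dyadic {a..<b}. carleson_avg (indicator (left_chain a b n)) J) \<le> 2"
  proof (rule SUP_least)
    fix J assume J: "J \<in> dyadic {a..<b}"
    then obtain m where "J \<in> dyadic_gen m {a..<b}" by (auto simp: dyadic_def)
    then obtain u v where uv: "J = {u..<v}" "u < v" using dyadic_genE[OF _ assms] by metis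
    have mJ: "0 < ennreal (measure lebesgue J)" using uv by simp
    have sub: "K \<subseteq> J" if "K \<in> dyadic J" for K
      using that uv unfolding UN_dyadic_below[symmetric] uv(1) by (auto elim!: dyadic_belowE)
    have fin: "finite (left_chain a b n \<inter> dyadic J)" by (simp add: finite_left_chain)
    have "(\<Sum>\<^sub>\<infinity>K\<in>dyadic J. ennreal (indicator (left_chain a b n) K * measure lebesgue K)) =
        (\<Sum>\<^sub>\<infinity>K\<in>left_chain a b n \<inter> dyadic J. ennreal (measure lebesgue K))"
      by (intro infsum_cong_neutral) auto
    also have "\<dots> = ennreal (\<Sum>K\<in>left_chain a b n \<inter> dyadic J. measure lebesgue K)"
      using fin by simp
    also have "\<dots> \<le> ennreal (\<Sum>K | K \<in> left_chain a b n \<and> K \<subseteq> J. measure lebesgue K)"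
      using sub finite_left_chain[of a b n] by (intro ennreal_leI sum_mono2) auto
    also have "\<dots> \<le> ennreal (2 * measure lebesgue J)"
      by (intro ennreal_leI left_chain_sum_le assms J)
    also have "\<dots> = ennreal (measure lebesgue J) * 2"
      unfolding mult.commute[of 2] by (simp add: ennreal_mult)
    finally show "carleson_avg (indicator (left_chain a b n)) J \<le> 2"
      unfolding carleson_avg_def by (rule divide_le_posI_ennreal[OF mJ])
  qed
qed

lemma avg_indicator:
  assumes "A \<in> sets lebesgue" "B \<in> sets lebesgue"
  shows "avg (indicator B) A = measure lebesgue (A \<inter> B) / measure lebesgue A"
proof -
  have "(LINT t:A|lebesgue. indicator B t) = (LINT t|lebesgue. indicator (A \<inter> B) t :: real)"
    unfolding set_lebesgue_integral_def by (simp add: indicator_inter_arith)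
  then show ?thesis using assms by (simp add: avg_def)
qed

text \<open>On the left interval of generation \<open>n\<close>, the ancestor of generation \<open>j\<close> contributes \<open>(2 ^ j / 2 ^ n) powr (1 / p)\<close>
since the function is the indicator of a \<open>2 ^ j / 2 ^ n\<close> part of it, and one of the two halves contributes \<open>1\<close>.\<close>

lemma sparse_op_left_chain_ge:
  assumes "a < b" "0 < p" "t \<in> left_dyadic a b n"
  shows "ennreal (1 + (\<Sum>j\<le>n. (2 ^ j / 2 ^ n) powr (1 / p)))
    \<le> sparse_op {a..<b} (indicator (left_chain a b n)) p (indicator (left_dyadic a b n)) t"
proof -
  define L where "L = b - a"
  have L: "0 < L" using assms by (simp add: L_def)
  define G where "G J = indicator (left_chain a b n) J *
    avg (\<lambda>s. \<bar>indicator (left_dyadic a b n) s\<bar> powr p) J powr (1 / p) * indicator J t" for J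
  have pw: "(\<lambda>s. \<bar>indicator (left_dyadic a b n) s\<bar> powr p) = indicator (left_dyadic a b n)"
    using assms(2) by (auto simp: indicator_def fun_eq_iff)
  have G: "G J = indicator (left_chain a b n) J *
      avg (indicator (left_dyadic a b n)) J powr (1 / p) * indicator J t" for J
    unfolding G_def pw by (rule refl)
  have meas: "left_dyadic a b j \<in> sets lebesgue" "last_right_half a b n \<in> sets lebesgue" for j
    by (simp_all add: left_dyadic_def last_right_half_def)
  have half: "L / 2 ^ Suc n < L / 2 ^ n" using L by (simp add: field_simps)
  have Gj: "G (left_dyadic a b j) = (2 ^ j / 2 ^ n) powr (1 / p)" if "j \<le> n" for j
  proof -
    have "L / 2 ^ n \<le> L / 2 ^ j"
      using L that by (intro divide_left_mono power_increasing) auto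
    then have sub: "left_dyadic a b n \<subseteq> left_dyadic a b j"
      by (auto simp: left_dyadic_def L_def)
    then have "left_dyadic a b j \<inter> left_dyadic a b n = left_dyadic a b n" by auto
    then have "avg (indicator (left_dyadic a b n)) (left_dyadic a b j) = 2 ^ j / 2 ^ n"
      using L by (simp add: avg_indicator meas measure_left_dyadic[OF assms(1)] flip: L_def)
    moreover have "left_dyadic a b j \<in> left_chain a b n" using that by (simp add: left_chain_def)
    ultimately show ?thesis using sub assms(3) by (auto simp: G)
  qed
  \<comment> \<open>the half of the last interval that contains \<open>t\<close>\<close>
  obtain H where H: "H \<in> left_chain a b n" "t \<in> H" "H \<subseteq> left_dyadic a b n"
    "measure lebesgue H = L / 2 ^ Suc n" "H \<in> sets lebesgue"
  proof (cases "t \<in> left_dyadic a b (Suc n)")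
    case True
    have "left_dyadic a b (Suc n) \<subseteq> left_dyadic a b n"
      using half by (auto simp: left_dyadic_def L_def)
    moreover have "left_dyadic a b (Suc n) \<in> left_chain a b n" by (simp add: left_chain_def)
    ultimately show ?thesis
      using that True meas measure_left_dyadic[OF assms(1)] L_def by metis
  next
    case False
    then have "t \<in> last_right_half a b n"
      using assms(3) by (auto simp: left_dyadic_def last_right_half_def)
    moreover have "0 \<le> L / 2 ^ Suc n" using L by simp
    then have "last_right_half a b n \<subseteq> left_dyadic a b n"
      by (auto simp: left_dyadic_def last_right_half_def L_def)
    moreover have "last_right_half a b n \<in> left_chain a b n" by (simp add: left_chain_def)
    ultimately show ?thesis
      using that meas measure_last_right_half[OF assms(1)] L_def by metis
  qed
  have "H \<inter> left_dyadic a b n = H" using H(3) by auto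
  then have GH: "G H = 1"
    using H L by (simp add: G avg_indicator meas)
  have inj: "inj_on (left_dyadic a b) {..n}"
  proof (rule inj_onI)
    fix i j assume "left_dyadic a b i = left_dyadic a b j"
    then have "L / 2 ^ i = L / 2 ^ j" using measure_left_dyadic[OF assms(1)] L_def by metis
    then show "i = j" using L by simp
  qed
  have new: "H \<notin> left_dyadic a b ` {..n}"
  proof
    assume "H \<in> left_dyadic a b ` {..n}"
    then obtain j where j: "j \<le> n" "H = left_dyadic a b j" by auto
    then have "L / 2 ^ Suc n = L / 2 ^ j" using measure_left_dyadic[OF assms(1)] L_def H(4) by metis
    then have "(2::real) ^ j = 2 ^ Suc n" using L by (simp add: field_simps)
    then have "j = Suc n" by (metis power_inject_exp one_less_numeral_iff semiring_norm(76))
    with j show False by simp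
  qed
  have G0: "0 \<le> G J" for J by (simp add: G_def)
  have "sum G (insert H (left_dyadic a b ` {..n})) = 1 + (\<Sum>j\<le>n. (2 ^ j / 2 ^ n) powr (1 / p))"
    using new inj by (simp add: GH sum.reindex Gj)
  then have "ennreal (1 + (\<Sum>j\<le>n. (2 ^ j / 2 ^ n) powr (1 / p))) =
      (\<Sum>J\<in>insert H (left_dyadic a b ` {..n}). ennreal (G J))"
    using G0 by (subst sum_ennreal) auto
  also have "\<dots> \<le> (\<Sum>\<^sub>\<infinity>J\<in>dyadic {a..<b}. ennreal (G J))"
    unfolding nonneg_infsum_complete[OF zero_le]
    by (rule SUP_upper) (use left_chain_subset_dyadic[OF assms(1), of n] H(1) in \<open>auto simp: left_chain_def\<close>)
  finally show ?thesis by (simp add: sparse_op_def G_def)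
qed

text \<open>With \<open>f\<close> the indicator of the left interval of generation \<open>n\<close>, the mean of \<open>f\<close> is the relative measure
of that interval, and the superlevel set contains it; so the quotient is at least the level itself.\<close>

lemma weak_norm_left_chain_ge:
  assumes "a < b" "0 < p"
  shows "ennreal (1 + (\<Sum>j\<le>n. (2 ^ j / 2 ^ n) powr (1 / p)))
    \<le> weak_norm {a..<b} (indicator (left_chain a b n)) p"
proof -
  define L where "L = b - a"
  have L: "0 < L" using assms by (simp add: L_def)
  define f where "f = (indicator (left_dyadic a b n) :: real \<Rightarrow> real)"
  have f0: "0 \<le> f t" for t by (simp add: f_def)
  define l where "l = 1 + (\<Sum>j\<le>n. (2 ^ j / 2 ^ n) powr (1 / p) :: real)"
  define E where "E = {t \<in> {a..<b}. ennreal l \<le> sparse_op {a..<b} (indicator (left_chain a b n)) p f t}"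
  have l: "0 < l" unfolding l_def by (intro add_pos_nonneg sum_nonneg) auto
  have pw: "(\<lambda>s. f s powr p) = f" "(\<lambda>s. \<bar>f s\<bar> powr p) = f"
    using assms(2) by (auto simp: indicator_def fun_eq_iff f_def)
  have meas: "left_dyadic a b n \<in> lmeasurable"
    by (rule bounded_set_imp_lmeasurable) (auto simp: left_dyadic_def)
  have "L / 2 ^ n \<le> L / 1" using L by (intro divide_left_mono) auto
  then have sub: "left_dyadic a b n \<subseteq> {a..<b}" by (auto simp: left_dyadic_def L_def)
  then have "{a..<b} \<inter> left_dyadic a b n = left_dyadic a b n" by auto
  then have av: "avg f {a..<b} = 1 / 2 ^ n"
    using assms meas by (simp add: f_def avg_indicator measure_left_dyadic fmeasurableD)
  have "integrable lebesgue f" using meas unfolding f_def by (intro integrable_real_indicator) (auto simp: fmeasurable_def)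
  then have "integrable (lebesgue_on {a..<b}) f"
    using integrable_mult_indicator[of "{a..<b}" lebesgue f] by (simp add: integrable_restrict_space)
  then have f: "f \<in> Lp_on p {a..<b}"
    by (auto simp: Lp_on_def pw)
  have adm: "f \<in> Lp_on p {a..<b} \<and> (\<forall>t\<in>{a..<b}. 0 \<le> f t) \<and>
      0 < avg (\<lambda>t. f t powr p) {a..<b} \<and> 0 < l"
    using f f0 l by (simp add: pw av)
  have "L / 2 ^ n \<le> measure lebesgue E"
    unfolding L_def measure_left_dyadic[OF assms(1), symmetric]
  proof (rule measure_mono_fmeasurable)
    show "left_dyadic a b n \<subseteq> E"
      using sparse_op_left_chain_ge[OF assms] sub by (auto simp: E_def l_def f_def)
    show "E \<in> lmeasurable"
      unfolding E_def
      by (rule sparse_op_superlevel_lmeasurable[OF assms(1) indicator_left_chain_carleson2[OF assms(1)]])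
  qed (use meas in auto)
  then have "1 \<le> 2 ^ n / L * measure lebesgue E" using L by (simp add: field_simps)
  then have "l powr p * 1 \<le> l powr p * (2 ^ n / L * measure lebesgue E)" by (intro mult_left_mono) auto
  then have "(l powr p) powr (1 / p) \<le> (l powr p / avg (\<lambda>s. f s powr p) {a..<b} *
      (1 / measure lebesgue {a..<b}) * measure lebesgue E) powr (1 / p)"
    using assms by (intro powr_mono2) (auto simp: pw av L_def)
  then have "ennreal l \<le> ennreal ((l powr p / avg (\<lambda>s. f s powr p) {a..<b} *
      (1 / measure lebesgue {a..<b}) * measure lebesgue E) powr (1 / p))"
    using assms l by (intro ennreal_leI) (simp add: powr_powr)
  also have "\<dots> \<le> weak_norm {a..<b} (indicator (left_chain a b n)) p"
    unfolding weak_norm_def E_def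
    by (rule SUP_upper2[of "(f, l)"], use adm in blast) (simp only: prod.case order_refl)
  finally show ?thesis by (simp add: l_def)
qed

text \<open>Counted from \<open>j = n\<close> downwards, the sum is a geometric series with ratio \<open>(1 / 2) powr r\<close>.\<close>

lemma chain_levels_tendsto:
  fixes r :: real
  assumes "0 < r"
  shows "(\<lambda>n. 1 + (\<Sum>j\<le>n. (2 ^ j / 2 ^ n) powr r)) \<longlonglongrightarrow> 1 + 2 powr r / (2 powr r - 1)"
proof -
  define q :: real where "q = (1 / 2) powr r"
  have "(1 / 2) powr r < 1 powr r" using assms by (intro powr_less_mono2) auto
  then have q: "0 < q" "q < 1" by (simp_all add: q_def)
  have pow: "((1 / 2) ^ k) powr r = q ^ k" for k
  proof (induction k)
    case (Suc k)
    then show ?case by (simp only: power_Suc powr_mult q_def)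
  qed simp
  have "(\<Sum>j\<le>n. (2 ^ j / 2 ^ n) powr r) = (\<Sum>j<Suc n. q ^ j)" for n
  proof -
    have "(2 ^ j / 2 ^ n) powr r = q ^ (Suc n - Suc j)" if "j < Suc n" for j
    proof -
      have "(2::real) ^ j / 2 ^ n = (1 / 2) ^ (n - j)"
        using that by (simp add: power_diff power_one_over)
      then show ?thesis by (simp only: pow diff_Suc_Suc)
    qed
    then have "(\<Sum>j\<le>n. (2 ^ j / 2 ^ n) powr r) = (\<Sum>j<Suc n. q ^ (Suc n - Suc j))"
      by (simp only: lessThan_Suc_atMost[symmetric]) (intro sum.cong, auto)
    also have "\<dots> = (\<Sum>j<Suc n. q ^ j)" by (rule sum.nat_diff_reindex)
    finally show ?thesis .
  qed
  moreover have "(\<lambda>n. \<Sum>j<Suc n. q ^ j) \<longlonglongrightarrow> 1 / (1 - q)"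
    using geometric_sums[of q] q unfolding sums_def by (intro LIMSEQ_Suc[of "\<lambda>n. \<Sum>j<n. q ^ j"]) auto
  moreover have "1 / (1 - q) = 2 powr r / (2 powr r - 1)"
    using assms by (simp add: q_def powr_divide field_simps)
  ultimately show ?thesis by (intro tendsto_add) auto
qed

theorem corollary1:
  fixes a b p :: real
  assumes "a < b" and "p \<ge> 1"
  shows "(SUP \<alpha>\<in>carleson2 {a..<b}. weak_norm {a..<b} \<alpha> p) =
           ennreal (sharp_const (1 / p) powr (1 / p))
         \<and> sharp_const (1 / p) powr (1 / p) =
           (2 * 2 powr (1 / p) - 1) / (2 powr (1 / p) - 1)"
proof -
  have p: "0 < p" using assms(2) by simp
  define q where "q = 2 powr (1 / p)"
  have q: "1 < q" using p by (simp add: q_def)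
  have cancel: "(x powr p) powr (1 / p) = x" if "0 < x" for x
    using that p by (simp add: powr_powr)
  have "sharp_const (1 / p) = ((2 * q - 1) / (q - 1)) powr p"
    by (simp add: sharp_const_def q_def powr_add mult.commute)
  then have sharp: "sharp_const (1 / p) powr (1 / p) = (2 * q - 1) / (q - 1)"
    using q cancel[of "(2 * q - 1) / (q - 1)"] by simp
  have C: "1 + q / (q - 1) = (2 * q - 1) / (q - 1)" using q by (simp add: field_simps)
  let ?S = "SUP \<alpha>\<in>carleson2 {a..<b}. weak_norm {a..<b} \<alpha> p"
  have "?S = ennreal (1 + q / (q - 1))"
  proof (rule antisym)
    show "?S \<le> ennreal (1 + q / (q - 1))"
      unfolding q_def by (intro SUP_least weak_norm_le assms(1) p)
    have "(\<lambda>n. ennreal (1 + (\<Sum>j\<le>n. (2 ^ j / 2 ^ n) powr (1 / p)))) \<longlonglongrightarrow> ennreal (1 + q / (q - 1))"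
      unfolding q_def using p by (intro tendsto_ennrealI chain_levels_tendsto) auto
    moreover have "ennreal (1 + (\<Sum>j\<le>n. (2 ^ j / 2 ^ n) powr (1 / p))) \<le> ?S" for n
      using weak_norm_left_chain_ge[OF assms(1) p]
      by (rule order_trans) (intro SUP_upper indicator_left_chain_carleson2 assms(1))
    ultimately show "ennreal (1 + q / (q - 1)) \<le> ?S"
      by (intro LIMSEQ_le_const2) auto
  qed
  then show ?thesis using sharp C by (simp add: q_def)
qed

end
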